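(* Let $n\ge 1$ be an integer and let $\ell=(T_{(i)}\mid i\ge 1)\in\operatorname{Lie}((V))$ be a log-signature. The following are equivalent: (1) $\ell$ is a pure $n$-volume path. (2) For every $k\ge 1$ we have $\varphi_k(\ell)=\frac{1}{h!}T_{(n)}^{\otimes h}$ if there exists $h\in\mathbb{N}$ such that $k=hn$, and $\varphi_k(\ell)=0$ otherwise. (3) There exists $k_0>n$ such that for every $k\ge k_0$ we have $\varphi_k(\ell)=\frac{1}{h!}T_{(n)}^{\otimes h}$ if there exists $h\in\mathbb{N}$ such that $k=hn$, and $\varphi_k(\ell)=0$ otherwise. Moreover, if any of these equivalent statements holds, then $\operatorname{rk}(\varphi_k(\ell))\le \operatorname{rk}(T_{(n)})^{k/n}$ whenever $k$ is a multiple of $n$.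
   Context: Let $\mathbb{K}\in\{\mathbb{R},\mathbb{C}\}$ and let $V$ be a finite-dimensional $\mathbb{K}$-vector space. On the tensor algebra of $V$ consider the Lie bracket $[T,S]=T\otimes S-S\otimes T$. $\operatorname{Lie}(V)$ is the smallest linear subspace of the tensor algebra that contains $V$ and is closed under brackets, and $\operatorname{Lie}^k(V)=\operatorname{Lie}(V)\cap V^{\otimes k}$. $\operatorname{Lie}((V))$ is the set of sequences $\ell=(T_{(i)}\mid i\ge 1)$ with $T_{(i)}\in\operatorname{Lie}^i(V)$ for every $i\ge1$ (the degree-zero entry being $0$); its elements are called log-signatures. For $k\ge 1$, $\varphi_k:\operatorname{Lie}((V))\to V^{\otimes k}$ is the degree-$k$ component of the exponential $\exp(T)=\sum_{n\ge0}T^{\otimes n}/n!$, i.e. $$\varphi_k(\ell)=\sum\frac{1}{t!}T_{(\alpha_1)}\otimes\cdots\otimes T_{(\alpha_t)},$$ the sum over all tuples of positive integers $(\alpha_1,\dots,\alpha_t)$ (of any length $t$) with $\alpha_1+\cdots+\alpha_t=k$. A log-signature $\ell=(T_{(i)}\mid i\ge 1)$ is a pure $n$-volume path if $T_{(i)}=0$ for every $i\ne n$. The rank $\operatorname{rk}(T)$ of $T\in V^{\otimes k}$ is the minimum number $r$ such that $T$ is a sum of $r$ elementary tensors $w_1\otimes\cdots\otimes w_k$, $w_i\in V$ (over $\mathbb{K}$). *)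

theory Defs
  imports Complex_Main "HOL-Library.Function_Algebras"
begin

text \<open>
  A vector space \<open>V\<close> is given by a scalar multiplication \<open>scale\<close> on the type \<open>'v\<close> that satisfies
  the library locale \<open>vector_space\<close>. Tensors are realised inside the multilinear functionals on the
  dual space: \<open>w\<^sub>1 \<otimes> \<dots> \<otimes> w\<^sub>k\<close> is the function \<open>(\<xi>\<^sub>1, \<dots>, \<xi>\<^sub>k) \<mapsto> \<xi>\<^sub>1 w\<^sub>1 \<cdots> \<xi>\<^sub>k w\<^sub>k\<close> of \<open>k\<close> linear forms, and
  \<open>V\<^bsup>\<otimes>k\<^esup>\<close> is the linear span of these. Elements of different degrees live in one type: a tensor is
  a function on lists of forms, and its degree \<open>k\<close> part is its restriction to lists of length \<open>k\<close>.
  Addition and zero are pointwise. The pointwise product from \<open>Function_Algebras\<close> is not used.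

  The definitions make sense over any field. The base field \<open>\<real>\<close> or \<open>\<complex>\<close> is expressed by the class
  \<open>real_normed_field\<close>: it contains \<open>real\<close> and \<open>complex\<close>, and by the Gelfand-Mazur theorem every field
  in it is isomorphic to one of the two.
\<close>

type_synonym ('k, 'v) tensor = "('v \<Rightarrow> 'k) list \<Rightarrow> 'k"

definition tscale :: "'k::field \<Rightarrow> ('k, 'v) tensor \<Rightarrow> ('k, 'v) tensor" where
  "tscale c T = (\<lambda>\<xi>s. c * T \<xi>s)"

lemma vector_space_tscale: "vector_space tscale"
  by unfold_locales (auto simp: tscale_def fun_eq_iff algebra_simps)

text \<open>Lists containing a function that is not a linear form are not arguments; there the value is
  fixed to be \<open>0\<close>.\<close>

definition elementary_tensor ::
    "('k::field \<Rightarrow> 'v::ab_group_add \<Rightarrow> 'v) \<Rightarrow> 'v list \<Rightarrow> ('k, 'v) tensor" where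
  "elementary_tensor scale ws =
     (\<lambda>\<xi>s. if length \<xi>s = length ws \<and> (\<forall>\<xi>\<in>set \<xi>s. Vector_Spaces.linear scale (*) \<xi>)
           then \<Prod>i<length ws. (\<xi>s ! i) (ws ! i) else 0)"

definition tensor_power ::
    "('k::field \<Rightarrow> 'v::ab_group_add \<Rightarrow> 'v) \<Rightarrow> nat \<Rightarrow> ('k, 'v) tensor set" where
  "tensor_power scale k = module.span tscale (elementary_tensor scale ` {ws. length ws = k})"

definition tensor_algebra ::
    "('k::field \<Rightarrow> 'v::ab_group_add \<Rightarrow> 'v) \<Rightarrow> ('k, 'v) tensor set" where
  "tensor_algebra scale = module.span tscale (range (elementary_tensor scale))"

definition tensor_mult ::
    "('k::field, 'v) tensor \<Rightarrow> ('k, 'v) tensor \<Rightarrow> ('k, 'v) tensor" (infixl \<open>\<otimes>\<close> 70) where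
  "S \<otimes> T = (\<lambda>\<xi>s. \<Sum>i\<le>length \<xi>s. S (take i \<xi>s) * T (drop i \<xi>s))"

definition tensor_one :: "('k::field, 'v) tensor" where
  "tensor_one = (\<lambda>\<xi>s. if \<xi>s = [] then 1 else 0)"

definition tensor_prod_list :: "('k::field, 'v) tensor list \<Rightarrow> ('k, 'v) tensor" where
  "tensor_prod_list Ts = foldr (\<otimes>) Ts tensor_one"

definition tensor_pow :: "('k::field, 'v) tensor \<Rightarrow> nat \<Rightarrow> ('k, 'v) tensor" where
  "tensor_pow T h = tensor_prod_list (replicate h T)"

text \<open>The following facts confirm that this is the usual tensor algebra: the elementary tensors
  are multilinear, the words in a basis are linearly independent, and the (evidently bilinear)
  product concatenates elementary tensors.\<close>

lemma elementary_tensor_Nil: "elementary_tensor scale [] = tensor_one"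
  by (auto simp: elementary_tensor_def tensor_one_def)

lemma prod_lessThan_add:
  "(\<Prod>i<m + n. f i) = (\<Prod>i<m. f i) * (\<Prod>i<n. f (m + i))" for f :: "nat \<Rightarrow> 'a::comm_monoid_mult"
  by (induction n) (simp_all add: mult.assoc)

lemma elementary_tensor_append:
  fixes scale :: "'k::field \<Rightarrow> 'v::ab_group_add \<Rightarrow> 'v"
  shows "elementary_tensor scale us \<otimes> elementary_tensor scale vs =
    elementary_tensor scale (us @ vs)"
proof
  fix \<xi>s :: "('v \<Rightarrow> 'k) list"
  let ?E = "elementary_tensor scale" and ?m = "length us"
  have "(?E us \<otimes> ?E vs) \<xi>s
      = (\<Sum>i\<le>length \<xi>s. if i = ?m then ?E us (take ?m \<xi>s) * ?E vs (drop ?m \<xi>s) else 0)"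
    unfolding tensor_mult_def by (rule sum.cong) (auto simp: elementary_tensor_def)
  also have "\<dots> = (if ?m \<le> length \<xi>s then ?E us (take ?m \<xi>s) * ?E vs (drop ?m \<xi>s) else 0)"
    by simp
  also have "\<dots> = ?E (us @ vs) \<xi>s"
  proof (cases "length \<xi>s = ?m + length vs")
    case True
    have lin: "(\<forall>\<xi>\<in>set \<xi>s. Vector_Spaces.linear scale (*) \<xi>) \<longleftrightarrow>
        (\<forall>\<xi>\<in>set (take ?m \<xi>s). Vector_Spaces.linear scale (*) \<xi>) \<and>
        (\<forall>\<xi>\<in>set (drop ?m \<xi>s). Vector_Spaces.linear scale (*) \<xi>)"
      by (metis Un_iff append_take_drop_id set_append)
    have "(\<Prod>i<?m + length vs. (\<xi>s ! i) ((us @ vs) ! i))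
        = (\<Prod>i<?m. (\<xi>s ! i) (us ! i)) * (\<Prod>i<length vs. (\<xi>s ! (?m + i)) (vs ! i))"
      by (simp add: prod_lessThan_add nth_append)
    then show ?thesis
      using True lin by (auto simp: elementary_tensor_def)
  qed (auto simp: elementary_tensor_def)
  finally show "(?E us \<otimes> ?E vs) \<xi>s = ?E (us @ vs) \<xi>s" .
qed

lemma elementary_tensor_linear_entry:
  fixes scale :: "'k::field \<Rightarrow> 'v::ab_group_add \<Rightarrow> 'v"
  shows "elementary_tensor scale (us @ (scale c v + w) # vs) =
    tscale c (elementary_tensor scale (us @ v # vs)) + elementary_tensor scale (us @ w # vs)"
proof
  fix \<xi>s :: "('v \<Rightarrow> 'k) list"
  let ?m = "length us" and ?N = "Suc (length us + length vs)"
  have split: "(\<Prod>i<?N. (\<xi>s ! i) ((us @ x # vs) ! i)) =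
      (\<xi>s ! ?m) x * (\<Prod>i\<in>{..<?N} - {?m}. (\<xi>s ! i) ((us @ v # vs) ! i))" for x
  proof -
    have "(\<Prod>i\<in>{..<?N} - {?m}. (\<xi>s ! i) ((us @ x # vs) ! i)) =
        (\<Prod>i\<in>{..<?N} - {?m}. (\<xi>s ! i) ((us @ v # vs) ! i))"
      by (rule prod.cong) (auto simp: nth_append nth_Cons')
    then show ?thesis
      by (subst prod.remove [of _ ?m]) auto
  qed
  show "elementary_tensor scale (us @ (scale c v + w) # vs) \<xi>s =
    (tscale c (elementary_tensor scale (us @ v # vs)) + elementary_tensor scale (us @ w # vs)) \<xi>s"
  proof (cases "length \<xi>s = ?N \<and> (\<forall>\<xi>\<in>set \<xi>s. Vector_Spaces.linear scale (*) \<xi>)")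
    case True
    then have "Vector_Spaces.linear scale (*) (\<xi>s ! ?m)"
      by simp
    then interpret Vector_Spaces.linear scale "(*)" "\<xi>s ! ?m" .
    have "(\<xi>s ! ?m) (scale c v + w) = c * (\<xi>s ! ?m) v + (\<xi>s ! ?m) w"
      by (simp add: add scale)
    moreover have "elementary_tensor scale (us @ x # vs) \<xi>s =
        (\<xi>s ! ?m) x * (\<Prod>i\<in>{..<?N} - {?m}. (\<xi>s ! i) ((us @ v # vs) ! i))" for x
      using True split [of x] by (simp add: elementary_tensor_def del: prod.lessThan_Suc)
    ultimately show ?thesis
      by (simp only: plus_fun_apply tscale_def distrib_right mult.assoc)
  qed (auto simp: elementary_tensor_def tscale_def)
qed

lemma elementary_tensor_basis_independent:
  assumes "vector_space scale" "\<not> module.dependent scale B" "module.span scale B = UNIV"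
  shows "inj_on (elementary_tensor scale) (lists B)"
    "\<not> module.dependent tscale (elementary_tensor scale ` lists B)"
proof -
  interpret V: vector_space scale by fact
  interpret T: vector_space tscale by (rule vector_space_tscale)
  define \<xi> where "\<xi> = map (\<lambda>b v. V.representation B v b)"
  have dual: "elementary_tensor scale us (\<xi> ws) = (if us = ws then 1 else 0)"
    if "us \<in> lists B" "ws \<in> lists B" for us ws
  proof -
    have "\<forall>f\<in>set (\<xi> ws). Vector_Spaces.linear scale (*) f"
      using assms by (auto simp: \<xi>_def V.linear_representation)
    then have "elementary_tensor scale us (\<xi> ws) =
        (if length ws = length us then \<Prod>i<length us. (\<xi> ws ! i) (us ! i) else 0)"
      by (simp add: elementary_tensor_def \<xi>_def)
    also have "\<dots> = (if length ws = length us
        then \<Prod>i<length us. if us ! i = ws ! i then 1 else 0 else 0)"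
      using that assms(2)
      by (auto simp: \<xi>_def V.representation_basis in_lists_conv_set intro!: prod.cong)
    also have "\<dots> = (if us = ws then 1 else 0)"
      by (auto simp: list_eq_iff_nth_eq)
    finally show ?thesis .
  qed
  show inj: "inj_on (elementary_tensor scale) (lists B)"
    by (rule inj_onI) (metis dual zero_neq_one)
  show "\<not> module.dependent tscale (elementary_tensor scale ` lists B)"
  proof
    assume "module.dependent tscale (elementary_tensor scale ` lists B)"
    then obtain S u where S: "finite S" "S \<subseteq> elementary_tensor scale ` lists B"
      and zero: "(\<Sum>T\<in>S. tscale (u T) T) = 0" and nz: "\<exists>T\<in>S. u T \<noteq> 0"
      unfolding T.dependent_explicit by auto
    from nz S(2) obtain ws where ws: "ws \<in> lists B" "elementary_tensor scale ws \<in> S"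
      "u (elementary_tensor scale ws) \<noteq> 0"
      by blast
    have ev: "(\<Sum>T\<in>S. tscale (u T) T) \<eta> = (\<Sum>T\<in>S. u T * T \<eta>)" for \<eta>
    proof -
      have "(\<Sum>T\<in>F. tscale (u T) T) \<eta> = (\<Sum>T\<in>F. u T * T \<eta>)" if "finite F" for F
        using that by (induction F rule: finite_induct) (auto simp: tscale_def)
      then show ?thesis
        using S(1) .
    qed
    have "0 = (\<Sum>T\<in>S. u T * T (\<xi> ws))"
      unfolding ev [symmetric] zero by simp
    also have "\<dots> = (\<Sum>T\<in>S. if T = elementary_tensor scale ws then u T else 0)"
    proof (rule sum.cong)
      fix T assume "T \<in> S"
      then obtain us where us: "us \<in> lists B" "T = elementary_tensor scale us"
        using S(2) by blast
      show "u T * T (\<xi> ws) = (if T = elementary_tensor scale ws then u T else 0)"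
        unfolding us(2) dual [OF us(1) ws(1)] inj_on_eq_iff [OF inj us(1) ws(1)]
        by (cases "us = ws") simp_all
    qed simp
    also have "\<dots> = u (elementary_tensor scale ws)"
      using S(1) ws(2) by simp
    finally show False
      using ws(3) by simp
  qed
qed

text \<open>\<open>Lie(V)\<close> is the smallest subspace of the tensor algebra that contains \<open>V\<close> (the elementary
  tensors with one factor) and is closed under brackets.\<close>

definition bracket :: "('k::field, 'v) tensor \<Rightarrow> ('k, 'v) tensor \<Rightarrow> ('k, 'v) tensor" where
  "bracket T S = T \<otimes> S - S \<otimes> T"

definition Lie :: "('k::field \<Rightarrow> 'v::ab_group_add \<Rightarrow> 'v) \<Rightarrow> ('k, 'v) tensor set" where
  "Lie scale = \<Inter>{L. L \<subseteq> tensor_algebra scale \<and> module.subspace tscale L \<and>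
     (\<forall>v. elementary_tensor scale [v] \<in> L) \<and> (\<forall>T\<in>L. \<forall>S\<in>L. bracket T S \<in> L)}"

definition Lie_deg :: "('k::field \<Rightarrow> 'v::ab_group_add \<Rightarrow> 'v) \<Rightarrow> nat \<Rightarrow> ('k, 'v) tensor set" where
  "Lie_deg scale k = Lie scale \<inter> tensor_power scale k"

definition log_signature ::
    "('k::field \<Rightarrow> 'v::ab_group_add \<Rightarrow> 'v) \<Rightarrow> (nat \<Rightarrow> ('k, 'v) tensor) \<Rightarrow> bool" where
  "log_signature scale l \<longleftrightarrow> l 0 = 0 \<and> (\<forall>i\<ge>1. l i \<in> Lie_deg scale i)"

definition compositions :: "nat \<Rightarrow> nat list set" where
  "compositions k = {\<alpha>. (\<forall>a\<in>set \<alpha>. a \<ge> 1) \<and> sum_list \<alpha> = k}"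

lemma finite_compositions: "finite (compositions k)"
proof -
  have "length \<alpha> \<le> sum_list \<alpha>" if "\<forall>a\<in>set \<alpha>. a \<ge> 1" for \<alpha> :: "nat list"
    using that by (induction \<alpha>) auto
  then have "compositions k \<subseteq> {\<alpha>. set \<alpha> \<subseteq> {..k} \<and> length \<alpha> \<le> k}"
    by (auto simp: compositions_def member_le_sum_list)
  then show ?thesis
    by (rule finite_subset) (simp add: finite_lists_length_le)
qed

definition sig_component ::
    "nat \<Rightarrow> (nat \<Rightarrow> ('k::field_char_0, 'v) tensor) \<Rightarrow> ('k, 'v) tensor" (\<open>\<phi>\<close>) where
  "\<phi> k l = (\<Sum>\<alpha>\<in>compositions k. tscale (1 / fact (length \<alpha>)) (tensor_prod_list (map l \<alpha>)))"

definition pure_volume_path :: "nat \<Rightarrow> (nat \<Rightarrow> ('k::field, 'v) tensor) \<Rightarrow> bool" where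
  "pure_volume_path n l \<longleftrightarrow> (\<forall>i\<ge>1. i \<noteq> n \<longrightarrow> l i = 0)"

text \<open>For \<open>k \<ge> 1\<close> scalars can be absorbed into a factor, so every tensor in \<open>V\<^bsup>\<otimes>k\<^esup>\<close> is a sum of
  elementary ones and the minimum is attained; the zero tensor has rank \<open>0\<close> (empty sum).\<close>

definition tensor_rank ::
    "('k::field \<Rightarrow> 'v::ab_group_add \<Rightarrow> 'v) \<Rightarrow> nat \<Rightarrow> ('k, 'v) tensor \<Rightarrow> nat" where
  "tensor_rank scale k T = (LEAST r. \<exists>wss. length wss = r \<and> (\<forall>ws\<in>set wss. length ws = k) \<and>
     T = sum_list (map (elementary_tensor scale) wss))"

text \<open>For \<open>n \<ge> 1\<close> there is at most one \<open>h\<close> with \<open>k = h * n\<close>.\<close>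

definition power_component :: "nat \<Rightarrow> (nat \<Rightarrow> ('k::field_char_0, 'v) tensor) \<Rightarrow> nat \<Rightarrow> bool" where
  "power_component n l k \<longleftrightarrow>
     (\<forall>h. k = h * n \<longrightarrow> \<phi> k l = tscale (1 / fact h) (tensor_pow (l n) h)) \<and>
     ((\<nexists>h. k = h * n) \<longrightarrow> \<phi> k l = 0)"

end

theory Submission
  imports Defs
begin

text \<open>
  If \<open>l\<close> is concentrated in degree \<open>n\<close>, the only composition of \<open>k\<close> that can contribute to \<open>\<phi> k l\<close> is
  \<open>(n, \<dots>, n)\<close>; this gives both the formula for \<open>\<phi> k l\<close> and, since a product of a sum of \<open>r\<close> with a
  sum of \<open>s\<close> elementary tensors is a sum of \<open>r * s\<close> of them, the bound on the rank.

  The substantial implication is that the formula in high degrees forces \<open>l\<close> to be pure. Let \<open>p\<close> be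
  the log-signature with the single entry \<open>l n\<close> in degree \<open>n\<close>. The hypothesis says that \<open>exp l\<close> and
  \<open>exp p\<close> agree in all degrees from some \<open>N\<close> on, and the claim is that they agree everywhere: \<open>l\<close>
  can then be recovered degree by degree, because \<open>\<phi> k l\<close> is \<open>l k\<close> plus a term that depends on
  lower degrees only (\<open>sig_component_eq_imp_eq\<close>).

  For this, a tensor series is read as a function on words of linear forms. Lie elements are
  primitive, that is, they vanish on the empty word, and their values sum to zero over the shuffles
  of any two nonempty words (\<open>Lie_primitive\<close>). Hence the exponential \<open>g\<close> of a log-signature is group-like: the sum of \<open>g\<close> over
  the shuffles of \<open>u\<close> and \<open>v\<close> is \<open>g u * g v\<close> (\<open>grouplike_tensor_exp\<close>). Let \<open>g\<close> and \<open>g'\<close> be group-like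
  and equal on long words. For a long \<open>v\<close> and any \<open>u\<close>, all shuffles are long, so
  \<open>g u * g v = g' u * g' v = g' u * g v\<close>. If \<open>g v \<noteq> 0\<close> for some long \<open>v\<close>, then \<open>g = g'\<close>. Otherwise both
  series vanish on long words, and then on all nonempty ones: if \<open>g w \<noteq> 0\<close>, then \<open>g w * g w \<noteq> 0\<close> is a
  sum of values of \<open>g\<close> on words of twice the length, so \<open>g\<close> is nonzero on arbitrarily long words
  (\<open>grouplike_eqI\<close>).
\<close>

section \<open>Sums over shuffles\<close>

text \<open>Shuffles are counted with multiplicity, as many times as the word arises by interleaving; the set
  of shuffles would lose this. As a function of \<open>(u, v)\<close> this is the coproduct of \<open>T\<close> dual to the
  shuffle product.\<close>

fun shuffle_sum :: "('a list \<Rightarrow> 'b::comm_monoid_add) \<Rightarrow> 'a list \<Rightarrow> 'a list \<Rightarrow> 'b" where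
  "shuffle_sum T [] v = T v"
| "shuffle_sum T (a # u) [] = T (a # u)"
| "shuffle_sum T (a # u) (b # v) =
     shuffle_sum (\<lambda>w. T (a # w)) u (b # v) + shuffle_sum (\<lambda>w. T (b # w)) (a # u) v"

lemma shuffle_sum_Nil_right [simp]: "shuffle_sum T u [] = T u"
  by (cases u) simp_all

lemma shuffle_sum_add:
  "shuffle_sum (\<lambda>w. S w + T w) u v = shuffle_sum S u v + shuffle_sum T u v"
proof (induction S u v arbitrary: T rule: shuffle_sum.induct)
  case (3 S a u b v)
  show ?case
    by (simp only: shuffle_sum.simps 3) (simp only: ac_simps)
qed simp_all

lemma shuffle_sum_mult_left:
  fixes T :: "'a list \<Rightarrow> 'b::semiring_0"
  shows "shuffle_sum (\<lambda>w. c * T w) u v = c * shuffle_sum T u v"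
  by (induction T u v rule: shuffle_sum.induct) (simp_all add: distrib_left)

lemma shuffle_sum_zero [simp]: "shuffle_sum (\<lambda>w::'a list. 0::'b::comm_monoid_add) u v = 0"
  by (induction "\<lambda>w::'a list. 0::'b::comm_monoid_add" u v rule: shuffle_sum.induct) simp_all

lemma shuffle_sum_sum:
  "shuffle_sum (\<lambda>w. \<Sum>t\<in>A. F t w) u v = (\<Sum>t\<in>A. shuffle_sum (F t) u v)"
  by (induction A rule: infinite_finite_induct) (simp_all add: shuffle_sum_add)

lemma shuffle_sum_cong:
  assumes "\<And>w. length w = length u + length v \<Longrightarrow> S w = T w"
  shows "shuffle_sum S u v = shuffle_sum T u v"
  using assms
proof (induction S u v arbitrary: T rule: shuffle_sum.induct)
  case (3 S a u b v)
  have "shuffle_sum (\<lambda>w. S (a # w)) u (b # v) = shuffle_sum (\<lambda>w. T (a # w)) u (b # v)"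
    by (rule 3(1)) (simp add: 3(3))
  moreover have "shuffle_sum (\<lambda>w. S (b # w)) (a # u) v = shuffle_sum (\<lambda>w. T (b # w)) (a # u) v"
    by (rule 3(2)) (simp add: 3(3))
  ultimately show ?case
    by simp
qed simp_all

text \<open>Removing the first letter is a twisted derivation of the tensor product. This matches the
  recursion of \<open>shuffle_sum\<close>, and so drives the induction in the next proof.\<close>

lemma tensor_mult_Cons:
  "(S \<otimes> T) (a # w) = ((\<lambda>w. S (a # w)) \<otimes> T) w + S [] * T (a # w)"
  by (simp add: tensor_mult_def sum.atMost_Suc_shift add.commute del: sum.atMost_Suc)

text \<open>The coproduct is multiplicative: cutting a shuffle of \<open>u\<close> and \<open>v\<close> into two pieces amounts to
  cutting \<open>u\<close> and \<open>v\<close> separately and shuffling the first pieces and the second pieces.\<close>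

theorem shuffle_sum_tensor_mult:
  "shuffle_sum (S \<otimes> T) u v = (\<Sum>i\<le>length u. \<Sum>j\<le>length v.
     shuffle_sum S (take i u) (take j v) * shuffle_sum T (drop i u) (drop j v))"
proof (induction S u v rule: shuffle_sum.induct)
  case (3 S a u b v)
  \<comment> \<open>In the double sum for \<open>a # u\<close> and \<open>b # v\<close>, the pair \<open>(0, 0)\<close> gives the term with \<open>S []\<close>; for every
    other pair the recursion splits the factor with \<open>S\<close> by its first letter.\<close>
  let ?F = "\<lambda>S u v. \<Sum>i\<le>length u. \<Sum>j\<le>length v.
     shuffle_sum S (take i u) (take j v) * shuffle_sum T (drop i u) (drop j v)"
  have "shuffle_sum (S \<otimes> T) (a # u) (b # v) =
      ?F (\<lambda>w. S (a # w)) u (b # v) + ?F (\<lambda>w. S (b # w)) (a # u) v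
        + S [] * shuffle_sum T (a # u) (b # v)"
    by (simp only: shuffle_sum.simps tensor_mult_Cons shuffle_sum_add shuffle_sum_mult_left 3)
       (simp only: ac_simps distrib_left)
  also have "\<dots> = ?F S (a # u) (b # v)"
    by (simp add: sum.atMost_Suc_shift sum.distrib algebra_simps del: sum.atMost_Suc)
  finally show ?case .
qed (simp_all add: tensor_mult_def)

section \<open>Lie elements are primitive\<close>

text \<open>In terms of the coproduct: \<open>T\<close> is sent to \<open>T \<boxtimes> 1 + 1 \<boxtimes> T\<close>.\<close>

definition primitive :: "('k::field, 'v) tensor \<Rightarrow> bool" where
  "primitive T \<longleftrightarrow> (\<forall>u v. shuffle_sum T u v = T u * tensor_one v + tensor_one u * T v)"

lemma primitive_Nil:
  assumes "primitive T"
  shows "T [] = 0"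
proof -
  have "T [] + T [] = T [] + 0"
    using assms [unfolded primitive_def, rule_format, of "[]" "[]"]
    unfolding shuffle_sum_Nil_right tensor_one_def if_P [OF refl] mult_1_right mult_1_left add_0_right
    by (rule sym)
  then show ?thesis
    by (simp only: add_left_cancel)
qed

lemma shuffle_sum_primitive_mult:
  assumes "primitive S"
  shows "shuffle_sum (S \<otimes> T) u v =
    (\<Sum>i\<le>length u. S (take i u) * shuffle_sum T (drop i u) v) +
    (\<Sum>j\<le>length v. S (take j v) * shuffle_sum T u (drop j v))"
proof -
  have one: "tensor_one (take i w) = (if i = 0 then 1 else 0)" if "i \<le> length w" for i w
    using that by (auto simp: tensor_one_def)
  have "shuffle_sum (S \<otimes> T) u v = (\<Sum>i\<le>length u. \<Sum>j\<le>length v.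
      (if j = 0 then S (take i u) * shuffle_sum T (drop i u) v else 0) +
      (if i = 0 then S (take j v) * shuffle_sum T u (drop j v) else 0))"
    unfolding shuffle_sum_tensor_mult using assms
    by (intro sum.cong refl) (auto simp: primitive_def one distrib_right)
  also have "\<dots> = (\<Sum>i\<le>length u. S (take i u) * shuffle_sum T (drop i u) v) +
      (\<Sum>i\<le>length u. \<Sum>j\<le>length v. if i = 0 then S (take j v) * shuffle_sum T u (drop j v) else 0)"
    by (simp add: sum.distrib)
  also have "(\<Sum>i\<le>length u. \<Sum>j\<le>length v.
        if i = 0 then S (take j v) * shuffle_sum T u (drop j v) else 0) =
      (\<Sum>j\<le>length v. S (take j v) * shuffle_sum T u (drop j v))"
    by (subst sum.swap) simp
  finally show ?thesis .
qed

lemma tensor_mult_one_right [simp]: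
  fixes T :: "('k::field, 'v) tensor"
  shows "T \<otimes> tensor_one = T"
proof
  fix w :: "('v \<Rightarrow> 'k) list"
  have "(T \<otimes> tensor_one) w = (\<Sum>i\<le>length w. if i = length w then T (take i w) else 0)"
    unfolding tensor_mult_def by (rule sum.cong) (auto simp: tensor_one_def)
  then show "(T \<otimes> tensor_one) w = T w"
    by simp
qed

text \<open>The two middle terms are symmetric in \<open>S\<close> and \<open>T\<close>, so they cancel in a bracket.\<close>

lemma shuffle_sum_mult_primitives:
  assumes "primitive S" "primitive T"
  shows "shuffle_sum (S \<otimes> T) u v =
    (S \<otimes> T) u * tensor_one v + S u * T v + T u * S v + tensor_one u * (S \<otimes> T) v"
proof -
  have one: "(\<Sum>i\<le>length w. S (take i w) * tensor_one (drop i w)) = S w" for w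
    using fun_cong [OF tensor_mult_one_right [of S], of w] by (simp add: tensor_mult_def)
  have T: "shuffle_sum T u v = T u * tensor_one v + tensor_one u * T v" for u v
    using assms(2) by (simp add: primitive_def)
  have "(\<Sum>i\<le>length u. S (take i u) * shuffle_sum T (drop i u) v) =
      (\<Sum>i\<le>length u. S (take i u) * T (drop i u)) * tensor_one v
      + (\<Sum>i\<le>length u. S (take i u) * tensor_one (drop i u)) * T v"
    by (simp only: T sum_distrib_right distrib_left sum.distrib mult.assoc)
  moreover have "(\<Sum>j\<le>length v. S (take j v) * shuffle_sum T u (drop j v)) =
      T u * (\<Sum>j\<le>length v. S (take j v) * tensor_one (drop j v))
      + tensor_one u * (\<Sum>j\<le>length v. S (take j v) * T (drop j v))"
    by (simp only: T sum_distrib_left distrib_left sum.distrib mult.left_commute)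
  ultimately show ?thesis
    unfolding shuffle_sum_primitive_mult [OF assms(1)] one by (simp add: tensor_mult_def)
qed

lemma primitive_bracket:
  assumes "primitive S" "primitive T"
  shows "primitive (bracket S T)"
proof -
  have "shuffle_sum (bracket S T) u v = shuffle_sum (S \<otimes> T) u v - shuffle_sum (T \<otimes> S) u v" for u v
  proof -
    have "bracket S T = (\<lambda>w. (S \<otimes> T) w + (- 1) * (T \<otimes> S) w)"
      by (simp add: bracket_def fun_eq_iff)
    then show ?thesis
      by (simp only: shuffle_sum_add shuffle_sum_mult_left) simp
  qed
  then show ?thesis
    unfolding primitive_def shuffle_sum_mult_primitives [OF assms]
      shuffle_sum_mult_primitives [OF assms(2,1)]
    by (simp add: bracket_def ring_distribs mult.commute)
qed

lemma elementary_tensor_homogeneous: "length w \<noteq> length ws \<Longrightarrow> elementary_tensor scale ws w = 0"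
  by (simp add: elementary_tensor_def)

lemma primitive_vector: "primitive (elementary_tensor scale [x])"
  unfolding primitive_def
proof (intro allI)
  fix u v
  let ?T = "elementary_tensor scale [x]"
  have "shuffle_sum ?T u v = shuffle_sum (\<lambda>w. 0) u v" if "u \<noteq> []" "v \<noteq> []"
  proof (rule shuffle_sum_cong, rule elementary_tensor_homogeneous)
    fix w assume "length w = length u + length v"
    moreover have "length u \<ge> 1" "length v \<ge> 1"
      using that by (auto simp: Suc_le_eq)
    ultimately show "length w \<noteq> length [x]"
      by simp
  qed
  then show "shuffle_sum ?T u v = ?T u * tensor_one v + tensor_one u * ?T v"
    by (cases "u = []"; cases "v = []")
       (simp_all add: tensor_one_def elementary_tensor_homogeneous)
qed

lemma subspace_primitive: "module.subspace tscale {T. primitive T}"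
proof -
  interpret T: vector_space tscale by (rule vector_space_tscale)
  show ?thesis
    by (rule T.subspaceI)
       (auto simp: primitive_def plus_fun_def zero_fun_def tscale_def shuffle_sum_add
         shuffle_sum_mult_left algebra_simps)
qed

lemma tensor_mult_add_left: "(S + S') \<otimes> T = S \<otimes> T + S' \<otimes> T"
  by (simp add: tensor_mult_def fun_eq_iff distrib_right sum.distrib)

lemma tensor_mult_add_right: "S \<otimes> (T + T') = S \<otimes> T + S \<otimes> T'"
  by (simp add: tensor_mult_def fun_eq_iff distrib_left sum.distrib)

lemma tensor_mult_zero_left [simp]: "0 \<otimes> T = 0"
  by (simp add: tensor_mult_def fun_eq_iff)

lemma tensor_mult_zero_right [simp]: "T \<otimes> 0 = 0"
  by (simp add: tensor_mult_def fun_eq_iff)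

lemma tensor_mult_tscale_left: "tscale c S \<otimes> T = tscale c (S \<otimes> T)"
  by (simp add: tensor_mult_def tscale_def fun_eq_iff sum_distrib_left mult.assoc)

lemma tensor_mult_tscale_right: "S \<otimes> tscale c T = tscale c (S \<otimes> T)"
  by (simp add: tensor_mult_def tscale_def fun_eq_iff sum_distrib_left mult.left_commute)

text \<open>\<open>Lie\<close> is an intersection over subspaces of the tensor algebra. For the primitive elements of the
  tensor algebra to be among these subspaces, the tensor algebra itself has to be closed under brackets.\<close>

lemma tensor_algebra_mult:
  assumes "S \<in> tensor_algebra scale" "T \<in> tensor_algebra scale"
  shows "S \<otimes> T \<in> tensor_algebra scale"
proof -
  interpret T: vector_space tscale by (rule vector_space_tscale)
  let ?A = "tensor_algebra scale"
  have sub: "T.subspace ?A"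
    unfolding tensor_algebra_def by (rule T.subspace_span)
  have e: "elementary_tensor scale us \<otimes> T \<in> ?A" for us
  proof -
    have "T \<in> T.span (range (elementary_tensor scale))"
      using assms(2) by (simp add: tensor_algebra_def)
    then show ?thesis
    proof (induction rule: T.span_induct_alt)
      case base
      show ?case
        using T.subspace_0 [OF sub] by (simp add: tensor_mult_def zero_fun_def)
    next
      case (step c x y)
      have "elementary_tensor scale us \<otimes> x \<in> ?A"
        using step(1) by (auto simp: elementary_tensor_append tensor_algebra_def intro: T.span_base)
      then show ?case
        unfolding tensor_mult_add_right tensor_mult_tscale_right
        using step(2) by (intro T.subspace_add [OF sub] T.subspace_scale [OF sub])
    qed
  qed
  have "S \<in> T.span (range (elementary_tensor scale))"
    using assms(1) by (simp add: tensor_algebra_def)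
  then show ?thesis
  proof (induction rule: T.span_induct_alt)
    case base
    show ?case
      using T.subspace_0 [OF sub] by (simp add: tensor_mult_def zero_fun_def)
  next
    case (step c x y)
    then show ?case
      unfolding tensor_mult_add_left tensor_mult_tscale_left
      using e by (intro T.subspace_add [OF sub] T.subspace_scale [OF sub]) auto
  qed
qed

lemma Lie_primitive:
  assumes "T \<in> Lie scale"
  shows "primitive T"
proof -
  interpret T: vector_space tscale by (rule vector_space_tscale)
  let ?A = "tensor_algebra scale"
  have sub: "T.subspace ?A"
    unfolding tensor_algebra_def by (rule T.subspace_span)
  have "bracket S T \<in> ?A" if "S \<in> ?A" "T \<in> ?A" for S T
    unfolding bracket_def using that by (intro T.subspace_diff [OF sub] tensor_algebra_mult)
  moreover have "elementary_tensor scale [v] \<in> ?A" for v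
    unfolding tensor_algebra_def by (intro T.span_base) simp
  ultimately have "Lie scale \<subseteq> ?A \<inter> {T. primitive T}"
    unfolding Lie_def
    by (intro Inter_lower)
       (auto intro: T.subspace_inter sub subspace_primitive primitive_bracket primitive_vector)
  then show ?thesis
    using assms by blast
qed

lemma tensor_power_homogeneous:
  assumes "T \<in> tensor_power scale k" "length w \<noteq> k"
  shows "T w = 0"
proof -
  interpret T: vector_space tscale by (rule vector_space_tscale)
  have "T \<in> T.span (elementary_tensor scale ` {ws. length ws = k})"
    using assms(1) by (simp add: tensor_power_def)
  then show ?thesis
    by (induction rule: T.span_induct_alt)
       (use assms(2) in \<open>auto simp: tscale_def elementary_tensor_homogeneous\<close>)
qed

section \<open>Exponentials of primitive series are group-like\<close>

definition grouplike :: "('k::field, 'v) tensor \<Rightarrow> bool" where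
  "grouplike g \<longleftrightarrow> g [] = 1 \<and> (\<forall>u v. shuffle_sum g u v = g u * g v)"

lemma tensor_pow_0 [simp]: "tensor_pow T 0 = tensor_one"
  by (simp add: tensor_pow_def tensor_prod_list_def)

lemma tensor_pow_Suc: "tensor_pow T (Suc h) = T \<otimes> tensor_pow T h"
  by (simp add: tensor_pow_def tensor_prod_list_def)

text \<open>With the factor \<open>1 / t!\<close> included, the coproduct of a power of a primitive element is a plain
  convolution without binomial coefficients.\<close>

definition divided_pow :: "('k::field_char_0, 'v) tensor \<Rightarrow> nat \<Rightarrow> ('k, 'v) tensor" where
  "divided_pow T t = tscale (1 / fact t) (tensor_pow T t)"

text \<open>On a word of length \<open>m\<close> the powers beyond the \<open>m\<close>-th vanish when \<open>T [] = 0\<close>, so for such \<open>T\<close> the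
  truncated sum is the full exponential series.\<close>

definition tensor_exp :: "('k::field_char_0, 'v) tensor \<Rightarrow> ('k, 'v) tensor" where
  "tensor_exp T = (\<lambda>w. \<Sum>t\<le>length w. divided_pow T t w)"

lemma divided_pow_Suc:
  fixes T :: "('k::field_char_0, 'v) tensor"
  shows
  "T \<otimes> divided_pow T t = tscale (of_nat (Suc t)) (divided_pow T (Suc t))"
proof -
  have "of_nat (Suc t) * (1 / fact (Suc t)) = (1 / fact t :: 'k)"
    by (simp add: field_simps del: of_nat_Suc)
  then show ?thesis
    unfolding divided_pow_def tensor_mult_tscale_right tensor_pow_Suc
    by (simp only: tscale_def mult.assoc [symmetric])
qed

lemma tensor_pow_eq_0:
  assumes "T [] = 0" "length w < t"
  shows "tensor_pow T t w = 0"
  using assms(2)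
proof (induction t arbitrary: w)
  case (Suc t)
  have "T (take i w) * tensor_pow T t (drop i w) = 0" if "i \<le> length w" for i
    using that Suc assms(1) by (cases "i = 0") auto
  then show ?case
    unfolding tensor_pow_Suc tensor_mult_def by (intro sum.neutral) simp
qed simp

text \<open>Induction on \<open>t\<close>, from \<open>(t + 1) P\<^sub>t\<^sub>+\<^sub>1 = L \<otimes> P\<^sub>t\<close> for the divided powers \<open>P\<^sub>t\<close>. The coproduct of the
  right side is the sum over \<open>s\<close> of \<open>s + (t + 1 - s)\<close> times \<open>P\<^sub>s \<boxtimes> P\<^sub>t\<^sub>+\<^sub>1\<^sub>-\<^sub>s\<close>, the two summands of the
  coefficient coming from \<open>L \<boxtimes> 1\<close> and from \<open>1 \<boxtimes> L\<close>.\<close>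

lemma shuffle_sum_divided_pow:
  fixes L :: "('k::field_char_0, 'v) tensor"
  assumes "primitive L"
  shows "shuffle_sum (divided_pow L t) u v = (\<Sum>s\<le>t. divided_pow L s u * divided_pow L (t - s) v)"
proof (induction t arbitrary: u v)
  case 0
  have "shuffle_sum tensor_one u v = tensor_one u * (tensor_one v :: 'k)"
  proof (cases "u = [] \<or> v = []")
    case True
    then show ?thesis
      by (auto simp: tensor_one_def)
  next
    case False
    then have "shuffle_sum tensor_one u v = shuffle_sum (\<lambda>w. 0 :: 'k) u v"
      by (intro shuffle_sum_cong) (auto simp: tensor_one_def)
    then show ?thesis
      using False by (simp add: tensor_one_def)
  qed
  then show ?case
    by (simp add: divided_pow_def tscale_def)
next
  case (Suc t)
  let ?P = "divided_pow L" and ?c = "of_nat :: nat \<Rightarrow> 'k"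
  have conv: "(\<Sum>i\<le>length w. L (take i w) * ?P s (drop i w)) = ?c (Suc s) * ?P (Suc s) w" for s w
  proof -
    have "(\<Sum>i\<le>length w. L (take i w) * ?P s (drop i w)) = (L \<otimes> ?P s) w"
      by (simp add: tensor_mult_def)
    then show ?thesis
      by (simp only: divided_pow_Suc tscale_def)
  qed
  have "?c (Suc t) * shuffle_sum (?P (Suc t)) u v = shuffle_sum (L \<otimes> ?P t) u v"
    unfolding divided_pow_Suc by (simp only: tscale_def shuffle_sum_mult_left)
  also have "\<dots> = (\<Sum>s\<le>t. (\<Sum>i\<le>length u. L (take i u) * ?P s (drop i u)) * ?P (t - s) v)
      + (\<Sum>s\<le>t. ?P s u * (\<Sum>j\<le>length v. L (take j v) * ?P (t - s) (drop j v)))"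
    unfolding shuffle_sum_primitive_mult [OF assms] Suc sum_distrib_left sum_distrib_right
    by (subst (1 2) sum.swap) (simp only: ac_simps)
  also have "\<dots> = (\<Sum>s\<le>t. ?c (Suc s) * (?P (Suc s) u * ?P (Suc t - Suc s) v))
      + (\<Sum>s\<le>t. ?c (Suc t - s) * (?P s u * ?P (Suc t - s) v))"
    unfolding conv by (intro arg_cong2 [where f = "(+)"] sum.cong)
      (auto simp: Suc_diff_le simp del: of_nat_Suc)
  also have "\<dots> = (\<Sum>s\<le>Suc t. ?c s * (?P s u * ?P (Suc t - s) v))
      + (\<Sum>s\<le>Suc t. ?c (Suc t - s) * (?P s u * ?P (Suc t - s) v))"
  proof -
    have "(\<Sum>s\<le>Suc t. ?c s * (?P s u * ?P (Suc t - s) v)) =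
        (\<Sum>s\<le>t. ?c (Suc s) * (?P (Suc s) u * ?P (Suc t - Suc s) v))"
      by (subst sum.atMost_Suc_shift) simp
    moreover have "(\<Sum>s\<le>Suc t. ?c (Suc t - s) * (?P s u * ?P (Suc t - s) v)) =
        (\<Sum>s\<le>t. ?c (Suc t - s) * (?P s u * ?P (Suc t - s) v))"
      by (subst sum.atMost_Suc) simp
    ultimately show ?thesis
      by (simp only:)
  qed
  also have "\<dots> = (\<Sum>s\<le>Suc t. (?c s + ?c (Suc t - s)) * (?P s u * ?P (Suc t - s) v))"
    by (simp only: sum.distrib distrib_right)
  also have "\<dots> = ?c (Suc t) * (\<Sum>s\<le>Suc t. ?P s u * ?P (Suc t - s) v)"
    unfolding sum_distrib_left by (intro sum.cong refl) (simp flip: of_nat_add)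
  finally show ?case
    by (simp only: mult_cancel_left of_nat_eq_0_iff) simp
qed

theorem grouplike_tensor_exp:
  fixes L :: "('k::field_char_0, 'v) tensor"
  assumes "primitive L"
  shows "grouplike (tensor_exp L)"
  unfolding grouplike_def
proof (intro conjI allI)
  show "tensor_exp L [] = 1"
    by (simp add: tensor_exp_def divided_pow_def tscale_def tensor_one_def)
next
  fix u v :: "('v \<Rightarrow> 'k) list"
  let ?P = "divided_pow L" and ?p = "length u" and ?q = "length v"
  have zero: "?P t w = 0" if "length w < t" for t w
    using tensor_pow_eq_0 [where T = L, OF primitive_Nil [OF assms] that] by (simp add: divided_pow_def tscale_def)
  then have nz: "t \<le> length w" if "?P t w \<noteq> 0" for t w
    using that not_le by blast
  have "shuffle_sum (tensor_exp L) u v = shuffle_sum (\<lambda>w. \<Sum>t\<le>?p + ?q. ?P t w) u v"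
    by (rule shuffle_sum_cong) (simp add: tensor_exp_def)
  also have "\<dots> = (\<Sum>t\<le>?p + ?q. \<Sum>s\<le>t. ?P s u * ?P (t - s) v)"
    by (simp add: shuffle_sum_sum shuffle_sum_divided_pow [OF assms])
  also have "\<dots> = (\<Sum>(s, r)\<in>{(s, r). s + r \<le> ?p + ?q}. ?P s u * ?P r v)"
    by (rule sum.triangle_reindex_eq [symmetric])
  also have "\<dots> = (\<Sum>(s, r)\<in>{..?p} \<times> {..?q}. ?P s u * ?P r v)"
  proof (rule sum.mono_neutral_right)
    have "{(s, r). s + r \<le> ?p + ?q} \<subseteq> {..?p + ?q} \<times> {..?p + ?q}"
      by auto
    then show "finite {(s, r). s + r \<le> ?p + ?q}"
      by (rule finite_subset) simp
  qed (auto dest: nz)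
  also have "\<dots> = tensor_exp L u * tensor_exp L v"
    by (simp add: tensor_exp_def sum_product sum.cartesian_product)
  finally show "shuffle_sum (tensor_exp L) u v = tensor_exp L u * tensor_exp L v" .
qed

text \<open>A nonzero value \<open>g v\<close> at a long word can be cancelled from \<open>g u * g v = g' u * g' v\<close>; if there is
  none, multiplicativity carries the vanishing from long words down to all nonempty ones.\<close>

theorem grouplike_eqI:
  assumes g: "grouplike g" and g': "grouplike g'"
    and agree: "\<And>w. N \<le> length w \<Longrightarrow> g w = g' w"
  shows "g = g'"
proof (cases "\<exists>v. N \<le> length v \<and> g v \<noteq> 0")
  case True
  then obtain v where v: "N \<le> length v" "g v \<noteq> 0"
    by blast
  show ?thesis
  proof
    fix u
    have "g u * g v = g' u * g' v"
      using shuffle_sum_cong [of u v g g'] agree v(1) g g' by (simp add: grouplike_def)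
    then show "g u = g' u"
      using v agree by simp
  qed
next
  case False
  \<comment> \<open>A nonzero value at \<open>w\<close> forces one at a word of twice the length, hence at arbitrarily long words.\<close>
  have "f u = 0" if f: "grouplike f" "\<And>w. N \<le> length w \<Longrightarrow> f w = 0" and "u \<noteq> []" for f u
  proof (rule ccontr)
    assume nz: "f u \<noteq> 0"
    have "\<exists>w. m < length w \<and> f w \<noteq> 0" for m
    proof (induction m)
      case 0
      then show ?case
        using nz \<open>u \<noteq> []\<close> by auto
    next
      case (Suc m)
      then obtain w where w: "m < length w" "f w \<noteq> 0"
        by blast
      then have "shuffle_sum f w w \<noteq> 0"
        using f(1) by (simp add: grouplike_def)
      then obtain x where "length x = length w + length w" "f x \<noteq> 0"
        using shuffle_sum_cong [of w w f "\<lambda>w. 0"] by auto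
      then show ?case
        using w(1) by (intro exI [of _ x]) simp
    qed
    then show False
      using f(2) by (meson less_imp_le)
  qed
  then have "g u = 0 \<and> g' u = 0" if "u \<noteq> []" for u
    using that False agree g g' by metis
  moreover have "g [] = g' []"
    using g g' by (simp add: grouplike_def)
  ultimately show ?thesis
    by (metis ext)
qed

section \<open>Signatures\<close>

definition graded :: "(nat \<Rightarrow> ('k::field, 'v) tensor) \<Rightarrow> bool" where
  "graded l \<longleftrightarrow> (\<forall>i w. length w \<noteq> i \<longrightarrow> l i w = 0)"

text \<open>For a graded sequence this is the formal sum of its entries.\<close>

definition total :: "(nat \<Rightarrow> ('k::field, 'v) tensor) \<Rightarrow> ('k, 'v) tensor" where
  "total l = (\<lambda>w. l (length w) w)"

lemma tensor_prod_list_Nil [simp]: "tensor_prod_list [] = tensor_one"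
  by (simp add: tensor_prod_list_def)

lemma tensor_prod_list_Cons [simp]: "tensor_prod_list (T # Ts) = T \<otimes> tensor_prod_list Ts"
  by (simp add: tensor_prod_list_def)

lemma homogeneous_tensor_mult:
  assumes "\<And>w. length w \<noteq> i \<Longrightarrow> S w = 0"
  shows "(S \<otimes> T) w = (if i \<le> length w then S (take i w) * T (drop i w) else 0)"
proof -
  have "(S \<otimes> T) w = (\<Sum>j\<le>length w. if j = i then S (take i w) * T (drop i w) else 0)"
    unfolding tensor_mult_def using assms by (intro sum.cong) auto
  then show ?thesis
    by simp
qed

lemma graded_tensor_prod_list:
  assumes "graded l" "length w \<noteq> sum_list \<alpha>"
  shows "tensor_prod_list (map l \<alpha>) w = 0"
  using assms(2)
proof (induction \<alpha> arbitrary: w)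
  case Nil
  then show ?case
    by (simp add: tensor_one_def)
next
  case (Cons i \<alpha>)
  have "(l i \<otimes> T) w = (if i \<le> length w then l i (take i w) * T (drop i w) else 0)" for T
    by (rule homogeneous_tensor_mult) (use assms(1) in \<open>simp add: graded_def\<close>)
  then show ?case
    using Cons by auto
qed

lemma tensor_pow_total:
  assumes "graded l" "l 0 = 0"
  shows "tensor_pow (total l) t w =
    (\<Sum>\<alpha>\<in>{\<alpha> \<in> compositions (length w). length \<alpha> = t}. tensor_prod_list (map l \<alpha>) w)"
proof (induction t arbitrary: w)
  case 0
  have "{\<alpha> \<in> compositions (length w). length \<alpha> = 0} = (if w = [] then {[]} else {})"
    by (auto simp: compositions_def)
  then show ?case
    by (simp add: tensor_one_def)
next
  case (Suc t)
  let ?C = "\<lambda>k t. {\<alpha> \<in> compositions k. length \<alpha> = t}" and ?k = "length w"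
  have mult: "(l i \<otimes> T) w = (if i \<le> ?k then l i (take i w) * T (drop i w) else 0)" for i T
    by (rule homogeneous_tensor_mult) (use assms(1) in \<open>simp add: graded_def\<close>)
  have "tensor_pow (total l) (Suc t) w = (\<Sum>i\<le>?k. total l (take i w) * tensor_pow (total l) t (drop i w))"
    by (simp add: tensor_pow_Suc tensor_mult_def)
  also have "\<dots> = (\<Sum>i\<in>{1..?k}. total l (take i w) * tensor_pow (total l) t (drop i w))"
    by (rule sum.mono_neutral_right) (auto simp: total_def assms(2) not_le)
  also have "\<dots> = (\<Sum>i\<in>{1..?k}. \<Sum>\<beta>\<in>?C (?k - i) t. tensor_prod_list (map l (i # \<beta>)) w)"
    unfolding Suc by (intro sum.cong refl) (simp add: total_def mult sum_distrib_left)
  also have "\<dots> = (\<Sum>(i, \<beta>)\<in>(SIGMA i:{1..?k}. ?C (?k - i) t). tensor_prod_list (map l (i # \<beta>)) w)"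
    by (rule sum.Sigma) (auto simp: finite_compositions)
  also have "\<dots> = (\<Sum>\<alpha>\<in>?C ?k (Suc t). tensor_prod_list (map l \<alpha>) w)"
    by (rule sum.reindex_bij_witness [where i = "\<lambda>\<alpha>. (hd \<alpha>, tl \<alpha>)" and j = "\<lambda>(i, \<beta>). i # \<beta>"])
       (auto simp: compositions_def length_Suc_conv)
  finally show ?case .
qed

lemma sum_fun_apply: "(\<Sum>x\<in>A. f x) w = (\<Sum>x\<in>A. f x w)"
  by (induction A rule: infinite_finite_induct) auto

lemma length_compositions: "\<alpha> \<in> compositions k \<Longrightarrow> length \<alpha> \<le> k"
proof -
  have "length \<alpha> \<le> sum_list \<alpha>" if "\<forall>a\<in>set \<alpha>. a \<ge> 1"
    using that by (induction \<alpha>) auto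
  then show "\<alpha> \<in> compositions k \<Longrightarrow> length \<alpha> \<le> k"
    by (auto simp: compositions_def)
qed

text \<open>The sum over compositions, sorted by their number of parts, is the exponential series of the
  formal sum of \<open>l\<close>.\<close>

lemma sig_component_apply:
  assumes "graded l" "l 0 = 0"
  shows "\<phi> k l w = (if length w = k then tensor_exp (total l) w else 0)"
proof (cases "length w = k")
  case True
  have "\<phi> k l w = (\<Sum>\<alpha>\<in>compositions k. 1 / fact (length \<alpha>) * tensor_prod_list (map l \<alpha>) w)"
    by (simp add: sig_component_def sum_fun_apply tscale_def)
  also have "\<dots> = (\<Sum>t\<le>k. \<Sum>\<alpha>\<in>{\<alpha> \<in> compositions k. length \<alpha> = t}.
      1 / fact (length \<alpha>) * tensor_prod_list (map l \<alpha>) w)"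
    by (rule sum.group [symmetric]) (auto simp: finite_compositions length_compositions)
  also have "\<dots> = (\<Sum>t\<le>k. 1 / fact t * tensor_pow (total l) t w)"
    by (intro sum.cong refl) (simp add: tensor_pow_total [OF assms] True sum_distrib_left)
  finally show ?thesis
    by (simp add: True tensor_exp_def divided_pow_def tscale_def)
next
  case False
  then have "tensor_prod_list (map l \<alpha>) w = 0" if "\<alpha> \<in> compositions k" for \<alpha>
    using that graded_tensor_prod_list [OF assms(1)] by (auto simp: compositions_def)
  then show ?thesis
    using False by (simp add: sig_component_def sum_fun_apply tscale_def)
qed

lemma log_signature_graded:
  fixes l :: "nat \<Rightarrow> ('k::field, 'v::ab_group_add) tensor"
  assumes "log_signature scale l"
  shows "graded l"
  unfolding graded_def
proof (intro allI impI)
  fix i and w :: "('v \<Rightarrow> 'k) list"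
  assume "length w \<noteq> i"
  then show "l i w = 0"
    using assms tensor_power_homogeneous [of "l i" scale i w]
    by (cases "i = 0") (auto simp: log_signature_def Lie_deg_def)
qed

lemma primitive_total:
  fixes l :: "nat \<Rightarrow> ('k::field, 'v::ab_group_add) tensor"
  assumes "log_signature scale l"
  shows "primitive (total l)"
  unfolding primitive_def
proof (intro allI)
  fix u v :: "('v \<Rightarrow> 'k) list"
  let ?T = "l (length u + length v)"
  have "primitive ?T"
  proof (cases "length u + length v = 0")
    case True
    have "primitive (0 :: ('k, 'v) tensor)"
      by (simp add: primitive_def zero_fun_def)
    then show ?thesis
      unfolding True using assms by (simp add: log_signature_def)
  next
    case False
    then show ?thesis
      using assms by (intro Lie_primitive [of _ scale]) (auto simp: log_signature_def Lie_deg_def Suc_le_eq)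
  qed
  moreover have "shuffle_sum (total l) u v = shuffle_sum ?T u v"
    by (rule shuffle_sum_cong) (simp add: total_def)
  ultimately show "shuffle_sum (total l) u v = total l u * tensor_one v + tensor_one u * total l v"
    by (auto simp: primitive_def total_def tensor_one_def)
qed

text \<open>The composition \<open>[k]\<close> contributes \<open>l k\<close> to \<open>\<phi> k l\<close>; all other compositions of \<open>k\<close> have only parts
  smaller than \<open>k\<close>, so induction applies.\<close>

lemma sig_component_eq_imp_eq:
  fixes l l' :: "nat \<Rightarrow> ('k::field_char_0, 'v) tensor"
  assumes l: "l 0 = l' 0" and eq: "\<And>k. k \<ge> 1 \<Longrightarrow> \<phi> k l = \<phi> k l'"
  shows "l = l'"
proof
  fix k
  show "l k = l' k"
  proof (induction k rule: less_induct)
    case (less k)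
    show ?case
    proof (cases "k = 0")
      case False
      let ?R = "\<lambda>l. \<Sum>\<alpha>\<in>compositions k - {[k]}.
        tscale (1 / fact (length \<alpha>)) (tensor_prod_list (map l \<alpha>))"
      have split: "\<phi> k m = m k + ?R m" for m :: "nat \<Rightarrow> ('k, 'v) tensor"
      proof -
        have "[k] \<in> compositions k"
          using False by (simp add: compositions_def)
        then have "\<phi> k m = tscale (1 / fact (length [k])) (tensor_prod_list (map m [k])) + ?R m"
          unfolding sig_component_def by (rule sum.remove [OF finite_compositions])
        then show ?thesis
          by (simp add: tscale_def)
      qed
      have "a < k" if "\<alpha> \<in> compositions k - {[k]}" "a \<in> set \<alpha>" for a \<alpha>
      proof -
        have pos: "\<forall>a\<in>set \<alpha>. a \<ge> 1" and sum: "sum_list \<alpha> = k" and "\<alpha> \<noteq> [k]"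
          using that(1) by (auto simp: compositions_def)
        from that(2) obtain xs ys where \<alpha>: "\<alpha> = xs @ a # ys"
          by (meson split_list)
        with \<open>\<alpha> \<noteq> [k]\<close> sum have "xs \<noteq> [] \<or> ys \<noteq> []"
          by auto
        moreover have "sum_list zs \<ge> 1" if "zs \<noteq> []" "\<forall>a\<in>set zs. a \<ge> 1" for zs :: "nat list"
          using that by (cases zs) auto
        ultimately have "sum_list xs + sum_list ys \<ge> 1"
          using pos \<alpha> by (metis Un_iff add_increasing add_increasing2 list.set_intros(2) set_append zero_le)
        then show ?thesis
          using sum \<alpha> by simp
      qed
      then have "?R l = ?R l'"
        using less by (intro sum.cong refl arg_cong2 [where f = tscale] arg_cong [where f = tensor_prod_list]) auto
      then show ?thesis
        using eq [of k] False by (simp add: split)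
    qed (simp add: l)
  qed
qed

text \<open>Being group-like, the two exponentials agree in all degrees once they agree in high degrees.\<close>

theorem log_signature_eqI:
  fixes l l' :: "nat \<Rightarrow> ('k::field_char_0, 'v::ab_group_add) tensor"
  assumes l: "log_signature scale l" and l': "log_signature scale l'"
    and eq: "\<And>k. k \<ge> N \<Longrightarrow> \<phi> k l = \<phi> k l'"
  shows "l = l'"
proof -
  have zero: "l 0 = 0" "l' 0 = 0"
    using l l' by (auto simp: log_signature_def)
  note app = sig_component_apply [OF log_signature_graded [OF l] zero(1)]
    sig_component_apply [OF log_signature_graded [OF l'] zero(2)]
  have "tensor_exp (total l) = tensor_exp (total l')"
  proof (rule grouplike_eqI)
    fix w :: "('v \<Rightarrow> 'k) list"
    assume "N \<le> length w"
    then have "\<phi> (length w) l w = \<phi> (length w) l' w"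
      by (simp add: eq)
    then show "tensor_exp (total l) w = tensor_exp (total l') w"
      by (simp add: app)
  qed (use l l' in \<open>auto intro: grouplike_tensor_exp primitive_total\<close>)
  then have "\<phi> k l = \<phi> k l'" for k
    by (simp add: app fun_eq_iff)
  then show ?thesis
    by (intro sig_component_eq_imp_eq) (simp_all add: zero)
qed

section \<open>Pure volume paths\<close>

lemma tensor_prod_list_eq_0: "0 \<in> set Ts \<Longrightarrow> tensor_prod_list Ts = 0"
  by (induction Ts) auto

lemma pure_volume_path_power_component:
  assumes "n \<ge> 1" "pure_volume_path n l"
  shows "power_component n l k"
proof -
  let ?f = "\<lambda>\<alpha>. tscale (1 / fact (length \<alpha>)) (tensor_prod_list (map l \<alpha>))"
  let ?B = "{\<alpha> \<in> compositions k. \<forall>a\<in>set \<alpha>. a = n}"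
  have "?f \<alpha> = 0" if "\<alpha> \<in> compositions k - ?B" for \<alpha>
  proof -
    have "0 \<in> set (map l \<alpha>)"
      using that assms(2) by (force simp: pure_volume_path_def compositions_def)
    then show ?thesis
      by (simp add: tensor_prod_list_eq_0 tscale_def fun_eq_iff)
  qed
  then have sum: "\<phi> k l = (\<Sum>\<alpha>\<in>?B. ?f \<alpha>)"
    unfolding sig_component_def
    by (intro sum.mono_neutral_right finite_compositions) auto
  have B: "\<alpha> \<in> ?B \<longleftrightarrow> (\<exists>h. k = h * n \<and> \<alpha> = replicate h n)" for \<alpha>
  proof
    assume "\<alpha> \<in> ?B"
    then have \<alpha>: "\<alpha> = replicate (length \<alpha>) n" and k: "sum_list \<alpha> = k"
      by (auto simp: compositions_def replicate_length_same)
    have "k = length \<alpha> * n"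
      unfolding k [symmetric] by (subst \<alpha>) (simp add: sum_list_replicate)
    then show "\<exists>h. k = h * n \<and> \<alpha> = replicate h n"
      using \<alpha> by blast
  qed (use assms(1) in \<open>auto simp: compositions_def sum_list_replicate\<close>)
  show ?thesis
    unfolding power_component_def
  proof (intro conjI allI impI)
    fix h assume h: "k = h * n"
    then have "?B = {replicate h n}"
      using B assms(1) by (intro set_eqI) auto
    then show "\<phi> k l = tscale (1 / fact h) (tensor_pow (l n) h)"
      unfolding sum by (simp add: tensor_pow_def)
  next
    assume "\<nexists>h. k = h * n"
    then have empty: "?B = {}"
      using B by blast
    show "\<phi> k l = 0"
      unfolding sum empty by (rule sum.empty)
  qed
qed

text \<open>From \<open>N\<close> on, the signature is that of the pure volume path with the same entry \<open>l n\<close>, so the two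
  log-signatures coincide.\<close>

lemma eventually_power_component_imp_pure:
  fixes l :: "nat \<Rightarrow> ('k::field_char_0, 'v::ab_group_add) tensor"
  assumes "n \<ge> 1" and l: "log_signature scale l"
    and pc: "\<And>k. k \<ge> N \<Longrightarrow> power_component n l k"
  shows "pure_volume_path n l"
proof -
  define p where "p = (\<lambda>i. if i = n then l n else 0)"
  have "0 \<in> Lie_deg scale i" for i
  proof -
    interpret T: vector_space tscale by (rule vector_space_tscale)
    show ?thesis
      by (auto simp: Lie_deg_def Lie_def tensor_power_def T.span_zero T.subspace_0)
  qed
  then have "log_signature scale p"
    using l assms(1) by (auto simp: log_signature_def p_def)
  have pure: "pure_volume_path n p"
    by (simp add: pure_volume_path_def p_def)
  have "\<phi> k l = \<phi> k p" if "k \<ge> N" for k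
    using pc [OF that] pure_volume_path_power_component [OF assms(1) pure, of k]
    unfolding power_component_def by (cases "\<exists>h. k = h * n") (auto simp: p_def)
  then have "l = p"
    by (rule log_signature_eqI [OF l \<open>log_signature scale p\<close>])
  then show ?thesis
    using pure by simp
qed

section \<open>Rank\<close>

text \<open>The property whose least \<open>r\<close> is \<open>tensor_rank\<close>. Upper bounds on the rank come from following
  explicit decompositions through products and scalings.\<close>

definition rank_decomposition ::
    "('k::field \<Rightarrow> 'v::ab_group_add \<Rightarrow> 'v) \<Rightarrow> nat \<Rightarrow> ('k, 'v) tensor \<Rightarrow> nat \<Rightarrow> bool" where
  "rank_decomposition scale k T r \<longleftrightarrow> (\<exists>wss. length wss = r \<and> (\<forall>ws\<in>set wss. length ws = k) \<and>
     T = sum_list (map (elementary_tensor scale) wss))"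

lemma tensor_rank_le: "rank_decomposition scale k T r \<Longrightarrow> tensor_rank scale k T \<le> r"
  unfolding tensor_rank_def rank_decomposition_def by (rule Least_le)

lemma rank_decomposition_tensor_rank:
  "rank_decomposition scale k T r \<Longrightarrow> rank_decomposition scale k T (tensor_rank scale k T)"
  unfolding tensor_rank_def rank_decomposition_def by (rule LeastI)

lemma elementary_tensor_scale_hd:
  assumes "vector_space scale"
  shows "elementary_tensor scale (scale c v # vs) = tscale c (elementary_tensor scale (v # vs))"
proof -
  interpret V: vector_space scale by fact
  have "elementary_tensor scale (0 # vs) = 0"
    using elementary_tensor_linear_entry [of scale "[]" 1 0 0 vs] by (simp add: tscale_def)
  then show ?thesis
    using elementary_tensor_linear_entry [of scale "[]" c v 0 vs] by simp
qed

text \<open>The scalar is absorbed into the first factor of each summand, which exists because \<open>k \<ge> 1\<close>.\<close>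

lemma rank_decomposition_tscale:
  fixes scale :: "'k::field \<Rightarrow> 'v::ab_group_add \<Rightarrow> 'v"
  assumes "vector_space scale" "k \<ge> 1" "rank_decomposition scale k T r"
  shows "rank_decomposition scale k (tscale c T) r"
proof -
  interpret T: vector_space tscale by (rule vector_space_tscale)
  let ?E = "elementary_tensor scale" and ?s = "\<lambda>ws. scale c (hd ws) # tl ws"
  obtain wss where wss: "length wss = r" "\<forall>ws\<in>set wss. length ws = k" "T = sum_list (map ?E wss)"
    using assms(3) by (auto simp: rank_decomposition_def)
  have "?E (?s ws) = tscale c (?E ws)" if "ws \<in> set wss" for ws
    using elementary_tensor_scale_hd [OF assms(1)] that wss(2) assms(2) by (cases ws) auto
  moreover have "tscale c (sum_list Ts) = sum_list (map (tscale c) Ts)" for Ts :: "('k, 'v) tensor list"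
    by (induction Ts)
       (simp_all only: list.map sum_list.Nil sum_list.Cons T.scale_zero_right T.scale_right_distrib)
  ultimately have "tscale c T = sum_list (map ?E (map ?s wss))"
    by (simp add: wss(3) o_def cong: map_cong)
  moreover have "\<forall>ws\<in>set (map ?s wss). length ws = k"
    using wss(2) assms(2) by auto
  ultimately show ?thesis
    unfolding rank_decomposition_def using wss(1) by (intro exI [of _ "map ?s wss"]) simp
qed

lemma rank_decomposition_mult:
  assumes "rank_decomposition scale k S r" "rank_decomposition scale m T s"
  shows "rank_decomposition scale (k + m) (S \<otimes> T) (r * s)"
proof -
  let ?E = "elementary_tensor scale"
  obtain uss where uss: "length uss = r" "\<forall>us\<in>set uss. length us = k" "S = sum_list (map ?E uss)"
    using assms(1) by (auto simp: rank_decomposition_def)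
  obtain vss where vss: "length vss = s" "\<forall>vs\<in>set vss. length vs = m" "T = sum_list (map ?E vss)"
    using assms(2) by (auto simp: rank_decomposition_def)
  let ?wss = "map (\<lambda>(us, vs). us @ vs) (List.product uss vss)"
  have "?E us \<otimes> sum_list (map ?E xss) = sum_list (map (\<lambda>vs. ?E (us @ vs)) xss)" for us xss
    by (induction xss)
       (simp_all only: list.map sum_list.Nil sum_list.Cons tensor_mult_zero_right
         tensor_mult_add_right elementary_tensor_append)
  then have "sum_list (map ?E xss) \<otimes> T =
      sum_list (map ?E (map (\<lambda>(us, vs). us @ vs) (List.product xss vss)))" for xss
    by (induction xss) (simp_all add: tensor_mult_add_left vss(3) o_def)
  then show ?thesis
    unfolding rank_decomposition_def using uss vss(1,2)
    by (intro exI [of _ ?wss]) auto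
qed

lemma rank_decomposition_pow:
  assumes "rank_decomposition scale k T r"
  shows "rank_decomposition scale (h * k) (tensor_pow T h) (r ^ h)"
proof (induction h)
  case 0
  show ?case
    unfolding rank_decomposition_def
    by (intro exI [of _ "[[]]"]) (simp add: elementary_tensor_Nil)
next
  case (Suc h)
  then show ?case
    using rank_decomposition_mult [OF assms Suc] by (simp add: tensor_pow_Suc)
qed

text \<open>Ensures that the rank of a tensor is attained by a decomposition: the \<open>LEAST\<close> of an empty
  set would be an arbitrary number, useless as an upper bound.\<close>

lemma rank_decomposition_exists:
  assumes "vector_space scale" "k \<ge> 1" "T \<in> tensor_power scale k"
  shows "\<exists>r. rank_decomposition scale k T r"
proof -
  interpret T: vector_space tscale by (rule vector_space_tscale)
  have "T \<in> T.span (elementary_tensor scale ` {ws. length ws = k})"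
    using assms(3) by (simp add: tensor_power_def)
  then show ?thesis
  proof (induction rule: T.span_induct_alt)
    case base
    then show ?case
      unfolding rank_decomposition_def by (intro exI [of _ 0] exI [of _ "[]"]) simp
  next
    case (step c x y)
    then obtain ws where ws: "length ws = k" "x = elementary_tensor scale ws"
      by blast
    have "rank_decomposition scale k x 1"
      unfolding rank_decomposition_def using ws by (intro exI [of _ "[ws]"]) simp
    then obtain wss where wss: "\<forall>ws\<in>set wss. length ws = k"
      "tscale c x = sum_list (map (elementary_tensor scale) wss)"
      using rank_decomposition_tscale [OF assms(1,2)] unfolding rank_decomposition_def by blast
    obtain vss where vss: "\<forall>ws\<in>set vss. length ws = k"
      "y = sum_list (map (elementary_tensor scale) vss)"
      using step(2) unfolding rank_decomposition_def by blast
    show ?case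
      unfolding rank_decomposition_def using wss vss
      by (intro exI [of _ "length (wss @ vss)"] exI [of _ "wss @ vss"]) auto
  qed
qed

lemma tensor_rank_pow_le:
  assumes "vector_space scale" "n \<ge> 1" "h \<ge> 1" "T \<in> tensor_power scale n"
  shows "tensor_rank scale (h * n) (tscale c (tensor_pow T h)) \<le> tensor_rank scale n T ^ h"
proof -
  obtain r where "rank_decomposition scale n T r"
    using rank_decomposition_exists assms by blast
  then have "rank_decomposition scale n T (tensor_rank scale n T)"
    by (rule rank_decomposition_tensor_rank)
  then show ?thesis
    using assms by (intro tensor_rank_le rank_decomposition_tscale rank_decomposition_pow) auto
qed

theorem theorem4p2:
  fixes scale :: "'k::real_normed_field \<Rightarrow> 'v::ab_group_add \<Rightarrow> 'v"
    and Basis :: "'v set"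
    and n :: nat
    and l :: "nat \<Rightarrow> ('k, 'v) tensor"
  assumes "finite_dimensional_vector_space scale Basis"
    and "n \<ge> 1"
    and "log_signature scale l"
  shows "(pure_volume_path n l \<longleftrightarrow> (\<forall>k\<ge>1. power_component n l k)) \<and>
    (pure_volume_path n l \<longleftrightarrow> (\<exists>k\<^sub>0>n. \<forall>k\<ge>k\<^sub>0. power_component n l k)) \<and>
    (pure_volume_path n l \<or> (\<forall>k\<ge>1. power_component n l k) \<or>
       (\<exists>k\<^sub>0>n. \<forall>k\<ge>k\<^sub>0. power_component n l k) \<longrightarrow>
     (\<forall>k\<ge>1. n dvd k \<longrightarrow>
        tensor_rank scale k (\<phi> k l) \<le> tensor_rank scale n (l n) ^ (k div n)))"
proof -
  have vs: "vector_space scale"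
    using assms(1) by (simp add: finite_dimensional_vector_space_def)
  have one_two: "power_component n l k" if "pure_volume_path n l" for k
    using pure_volume_path_power_component [OF assms(2) that] .
  have three_one: "pure_volume_path n l" if "\<forall>k\<ge>k\<^sub>0. power_component n l k" for k\<^sub>0
    using eventually_power_component_imp_pure [OF assms(2,3)] that by blast
  have rank: "tensor_rank scale k (\<phi> k l) \<le> tensor_rank scale n (l n) ^ (k div n)"
    if "pure_volume_path n l" "k \<ge> 1" "n dvd k" for k
  proof -
    obtain h where h: "k = h * n"
      using \<open>n dvd k\<close> by (metis dvd_def mult.commute)
    have "l n \<in> tensor_power scale n"
      using assms(2,3) by (auto simp: log_signature_def Lie_deg_def)
    moreover have "h \<ge> 1" "k div n = h"
      using h assms(2) \<open>k \<ge> 1\<close> by (auto simp: Suc_le_eq)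
    moreover have "\<phi> k l = tscale (1 / fact h) (tensor_pow (l n) h)"
      using one_two [OF that(1), of k] h by (auto simp: power_component_def)
    ultimately show ?thesis
      using tensor_rank_pow_le [OF vs assms(2), of h "l n" "1 / fact h"] h by simp
  qed
  have "pure_volume_path n l \<longleftrightarrow> (\<exists>k\<^sub>0>n. \<forall>k\<ge>k\<^sub>0. power_component n l k)"
    using one_two three_one by (metis lessI)
  moreover have "pure_volume_path n l \<longleftrightarrow> (\<forall>k\<ge>1. power_component n l k)"
    using one_two three_one by blast
  ultimately show ?thesis
    using rank by blast
qed

end
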